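(* Let $n\ge4$ and let $(\mathfrak{s}^{2}_{n,1},\cdot,[-,-])$ be a transposed Poisson algebra structure on the Lie algebra $\mathfrak{s}^{2}_{n,1}$. Then there are complex numbers $\alpha_4,\dots,\alpha_n,\gamma_1,\gamma_2$ such that the multiplication $\cdot$ is given by $$e_1\cdot e_1=\sum_{t=4}^n\alpha_te_t,\quad e_1\cdot x=\sum_{t=3}^{n-1}\alpha_{t+1}e_t+\gamma_1e_n,\quad x\cdot x=\sum_{t=2}^{n-2}\alpha_{t+2}e_t+\gamma_1e_{n-1}+\gamma_2e_n,$$ where products of basis elements that are not listed (up to commutativity) are zero.
   Context: All algebras are over $\mathbb{C}$. A transposed Poisson algebra is a vector space $\mathfrak{L}$ with bilinear operations $\cdot$ and $[-,-]$ such that $(\mathfrak{L},\cdot)$ is a commutative associative algebra, $(\mathfrak{L},[-,-])$ is a Lie algebra, and $2z\cdot[u,v]=[z\cdot u,v]+[u,z\cdot v]$ for all $u,v,z\in\mathfrak{L}$. A transposed Poisson structure on a Lie algebra $(\mathfrak{L},[-,-])$ is an operation $\cdot$ making $(\mathfrak{L},\cdot,[-,-])$ a transposed Poisson algebra. $\mathfrak{s}^{2}_{n,1}$ is the $(n+1)$-dimensional Lie algebra with basis $e_1,\dots,e_n,x$ and brackets $[e_i,e_1]=e_{i+1}$ for $2\le i\le n-1$; $[e_i,x]=e_i$ for $2\le i\le n$; brackets of basis elements not determined by these and antisymmetry are zero. *)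

theory Defs
  imports "HOL-Analysis.Cartesian_Space"
begin

locale complex_bilinear =
  vector_space scale
  for scale :: "complex \<Rightarrow> 'v::ab_group_add \<Rightarrow> 'v" +
  fixes f :: "'v \<Rightarrow> 'v \<Rightarrow> 'v"
  assumes linear_left: "Vector_Spaces.linear scale scale (\<lambda>u. f u v)"
    and linear_right: "Vector_Spaces.linear scale scale (\<lambda>v. f u v)"

locale complex_lie_algebra =
  complex_bilinear scale bracket
  for scale :: "complex \<Rightarrow> 'v::ab_group_add \<Rightarrow> 'v"
    and bracket :: "'v \<Rightarrow> 'v \<Rightarrow> 'v" +
  assumes alternating: "bracket u u = 0"
    and jacobi: "bracket u (bracket v w) + bracket v (bracket w u) + bracket w (bracket u v) = 0"

locale complex_comm_assoc_algebra =
  complex_bilinear scale mult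
  for scale :: "complex \<Rightarrow> 'v::ab_group_add \<Rightarrow> 'v"
    and mult :: "'v \<Rightarrow> 'v \<Rightarrow> 'v" +
  assumes commute: "mult u v = mult v u"
    and assoc: "mult (mult u v) w = mult u (mult v w)"

locale transposed_poisson_algebra =
  complex_comm_assoc_algebra scale mult + complex_lie_algebra scale bracket
  for scale :: "complex \<Rightarrow> 'v::ab_group_add \<Rightarrow> 'v"
    and mult bracket :: "'v \<Rightarrow> 'v \<Rightarrow> 'v" +
  assumes compatible:
    "scale 2 (mult z (bracket u v)) = bracket (mult z u) v + bracket u (mult z v)"

text \<open>
  The Lie algebra \<open>\<ss>\<^sup>2\<close> of dimension \<open>n + 1\<close>, given as an arbitrary Lie algebra together with a
  basis \<open>e 1, \<dots>, e n, x\<close> having the prescribed structure constants. The underlying vector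
  space is the whole type, and the values of \<open>e\<close> outside \<open>{1..n}\<close> are irrelevant.
  Brackets with the two arguments exchanged are fixed by antisymmetry.
\<close>

locale s2_lie_algebra =
  complex_lie_algebra scale bracket
  for scale :: "complex \<Rightarrow> 'v::ab_group_add \<Rightarrow> 'v"
    and bracket :: "'v \<Rightarrow> 'v \<Rightarrow> 'v" +
  fixes n :: nat and e :: "nat \<Rightarrow> 'v" and x :: 'v
  assumes inj_e: "inj_on e {1..n}"
    and x_notin: "x \<notin> e ` {1..n}"
    and independent_basis: "independent (insert x (e ` {1..n}))"
    and span_basis: "span (insert x (e ` {1..n})) = UNIV"
    and bracket_e_e1: "\<lbrakk>2 \<le> i; i \<le> n - 1\<rbrakk> \<Longrightarrow> bracket (e i) (e 1) = e (i + 1)"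
    and bracket_en_e1: "bracket (e n) (e 1) = 0"
    and bracket_e_e: "\<lbrakk>2 \<le> i; i \<le> n; 2 \<le> j; j \<le> n\<rbrakk> \<Longrightarrow> bracket (e i) (e j) = 0"
    and bracket_e_x: "\<lbrakk>2 \<le> i; i \<le> n\<rbrakk> \<Longrightarrow> bracket (e i) x = e i"
    and bracket_e1_x: "bracket (e 1) x = 0"

text \<open>Such a Lie algebra exists on every coordinate space of dimension \<open>n + 1\<close>.\<close>

lemma s2_lie_algebra_exists:
  assumes "CARD('k::finite) = n + 1" "n \<ge> 2"
  shows "\<exists>bracket e x. s2_lie_algebra ((*s) :: complex \<Rightarrow> complex ^ 'k \<Rightarrow> _) bracket n e x"
proof -
  obtain b where b: "bij_betw b {0..n} (UNIV :: 'k set)"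
    using assms by (metis card_atLeastAtMost ex_bij_betw_nat_finite finite atLeast0AtMost
        atLeastLessThanSuc_atLeastAtMost Suc_eq_plus1)
  define c where "c = inv_into {0..n} b"
  have cb: "c (b i) = i" if "i \<le> n" for i
    using b that by (simp add: c_def bij_betw_def)
  have bc: "b (c k) = k" "c k \<le> n" for k
    using b unfolding c_def bij_betw_def
    by (metis UNIV_I f_inv_into_f, metis UNIV_I inv_into_into atLeastAtMost_iff)
  define e where "e i = (axis (b i) 1 :: complex ^ 'k)" for i
  define br :: "complex ^ 'k \<Rightarrow> complex ^ 'k \<Rightarrow> complex ^ 'k" where
    "br u v = (\<chi> k. (if c k \<ge> 2 then u $ k * v $ b 0 - v $ k * u $ b 0 else 0) +
       (if c k \<ge> 3 then u $ b (c k - 1) * v $ b 1 - v $ b (c k - 1) * u $ b 1 else 0))" for u v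
  have b_eq: "b i = b j \<longleftrightarrow> i = j" if "i \<le> n" "j \<le> n" for i j
    using that cb by metis
  have br_nth: "br u v $ b i = (if i \<ge> 2 then u $ b i * v $ b 0 - v $ b i * u $ b 0 else 0) +
      (if i \<ge> 3 then u $ b (i - 1) * v $ b 1 - v $ b (i - 1) * u $ b 1 else 0)"
    if "i \<le> n" for u v i
    using that by (simp add: br_def cb)
  have e_nth: "e i $ b j = (if i = j then 1 else 0)" if "i \<le> n" "j \<le> n" for i j
    using that by (auto simp: e_def axis_def b_eq)
  have vecI: "u = v" if "\<And>i. i \<le> n \<Longrightarrow> u $ b i = v $ b i" for u v :: "complex ^ 'k"
    using that by (metis bc vec_eq_iff)
  have im: "insert (e 0) (e ` {1..n}) = cart_basis"
  proof -
    have "insert (e 0) (e ` {1..n}) = e ` {0..n}"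
      by (metis image_insert atLeastAtMost_insertL le0 One_nat_def)
    also have "\<dots> = (\<lambda>k. axis k 1) ` b ` {0..n}"
      by (auto simp: e_def image_image)
    also have "\<dots> = cart_basis"
      using b by (auto simp: bij_betw_def cart_basis_def)
    finally show ?thesis .
  qed
  have inj: "inj_on e {0..n}"
    using b by (auto simp: e_def inj_on_def axis_eq_axis bij_betw_def)
  have "s2_lie_algebra (*s) br n e (e 0)"
  proof
    show "br (a + a') v = br a v + br a' v" "br v (a + a') = br v a + br v a'" for a a' v
      by (auto simp: br_def vec_eq_iff algebra_simps)
    show "br (r *s a) v = r *s br a v" "br v (r *s a) = r *s br v a" for r a v
      by (auto simp: br_def vec_eq_iff algebra_simps)
    show "br u u = 0" for u
      by (auto simp: br_def vec_eq_iff)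
    show "br u (br v w) + br v (br w u) + br w (br u v) = 0" for u v w
    proof (rule vecI)
      fix i assume i: "i \<le> n"
      consider "i < 2" | "i = 2" | "i = 3" | m where "i = Suc m" "m \<ge> 3"
        by (cases i) (auto, linarith)
      then show "(br u (br v w) + br v (br w u) + br w (br u v)) $ b i = 0 $ b i"
        by cases (use i assms(2) in \<open>simp_all add: br_nth algebra_simps\<close>)
    qed
    show "inj_on e {1..n}" using inj by (rule inj_on_subset) auto
    show "e 0 \<notin> e ` {1..n}" using inj by (force simp: inj_on_def)
    show "vec.independent (insert (e 0) (e ` {1..n}))"
      "vec.span (insert (e 0) (e ` {1..n})) = UNIV"
      unfolding im using independent_cart_basis span_cart_basis by auto
    show "br (e i) (e 1) = e (i + 1)" if "2 \<le> i" "i \<le> n - 1" for i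
      by (rule vecI) (use that in \<open>auto simp: br_nth e_nth\<close>)
    show "br (e n) (e 1) = 0"
      by (rule vecI) (use assms in \<open>auto simp: br_nth e_nth\<close>)
    show "br (e i) (e j) = 0" if "2 \<le> i" "i \<le> n" "2 \<le> j" "j \<le> n" for i j
      by (rule vecI) (use that in \<open>auto simp: br_nth e_nth\<close>)
    show "br (e i) (e 0) = e i" if "2 \<le> i" "i \<le> n" for i
      by (rule vecI) (use that in \<open>auto simp: br_nth e_nth\<close>)
    show "br (e 1) (e 0) = 0"
      by (rule vecI) (use assms in \<open>auto simp: br_nth e_nth\<close>)
  qed
  then show ?thesis by blast
qed

end

theory Submission
  imports Defs
begin

text \<open>
  By compatibility every multiplication operator \<open>\<phi>\<close> is a half-derivation, i.e.
  \<open>2 \<phi>[u,v] = [\<phi> u,v] + [u,\<phi> v]\<close>. Let \<open>N\<close> be the span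
  of \<open>e 2, \<dots>, e n\<close>. Since \<open>x\<close> acts on the abelian ideal \<open>N\<close> as the identity and \<open>e 1\<close> as a
  nilpotent operator \<open>S\<close> with \<open>S\<^sup>2 \<noteq> 0\<close>, a half-derivation is a scalar \<open>d\<close> plus the map that sends
  \<open>x\<close> to some \<open>w \<in> N\<close>, \<open>e 1\<close> to \<open>S w\<close> and \<open>N\<close> to \<open>0\<close>. Commutativity of the product then forces all
  the scalars to vanish and \<open>N\<close> to annihilate everything, so the product is determined by
  \<open>w = x \<bullet> x \<in> N\<close> through \<open>e 1 \<bullet> x = S w\<close> and \<open>e 1 \<bullet> e 1 = S (S w)\<close>.
\<close>

context complex_bilinear
begin

lemma add_left: "f (u + u') v = f u v + f u' v"
  and scale_left: "f (scale r u) v = scale r (f u v)"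
  using linear_left[of v, folded module_hom_iff_linear]
  by (auto dest: module_hom.add module_hom.scale)

lemma add_right: "f v (u + u') = f v u + f v u'"
  and scale_right: "f v (scale r u) = scale r (f v u)"
  using linear_right[of v, folded module_hom_iff_linear]
  by (simp_all add: module_hom.add module_hom.scale)

lemma zero_left: "f 0 v = 0"
  using scale_left[of 0 0 v] by simp

lemma sum_left: "f (\<Sum>i\<in>A. g i) v = (\<Sum>i\<in>A. f (g i) v)"
  by (induction A rule: infinite_finite_induct) (simp_all add: zero_left add_left)

end

context s2_lie_algebra
begin

text \<open>The \<open>N\<close> of the overview. It is the derived algebra: each of its generators
  \<open>e i\<close> equals \<open>bracket (e i) x\<close>.\<close>

definition abelian_ideal :: "'v set" where
  "abelian_ideal = span (e ` {2..n})"

lemma antisym: "bracket u v = - bracket v u"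
proof -
  have "bracket (u + v) (u + v) = 0" by (rule alternating)
  then show ?thesis
    by (simp add: add_left add_right alternating[of u] alternating[of v] eq_neg_iff_add_eq_0 add.commute)
qed

lemma subspace_abelian_ideal: "subspace abelian_ideal"
  by (simp add: abelian_ideal_def)

lemma e_in_abelian_ideal: "2 \<le> i \<Longrightarrow> i \<le> n \<Longrightarrow> e i \<in> abelian_ideal"
  by (auto simp: abelian_ideal_def intro: span_base)

lemma abelian_ideal_expansion:
  assumes "v \<in> abelian_ideal"
  obtains c where "v = (\<Sum>t=2..n. scale (c t) (e t))"
proof -
  have inj: "inj_on e {2..n}"
    using inj_e by (rule inj_on_subset) auto
  obtain r where "v = (\<Sum>b\<in>e ` {2..n}. scale (r b) b)"
    using assms by (auto simp: abelian_ideal_def span_finite)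
  then have "v = (\<Sum>t=2..n. scale (r (e t)) (e t))"
    by (simp add: sum.reindex[OF inj])
  then show thesis by (rule that)
qed

lemma decompose:
  assumes "n \<ge> 1"
  obtains a b v where "v \<in> abelian_ideal" "u = scale a (e 1) + scale b x + v"
proof -
  have "{1..n} = insert 1 {2..n}" using assms by auto
  then have "u \<in> span (insert x (insert (e 1) (e ` {2..n})))"
    using span_basis by simp
  then obtain a b where "u - scale b x - scale a (e 1) \<in> abelian_ideal"
    by (auto simp: span_insert abelian_ideal_def)
  then show thesis by (rule that) (simp add: algebra_simps)
qed

lemma bracket_x:
  assumes "v \<in> abelian_ideal" shows "bracket v x = v"
proof -
  obtain c where "v = (\<Sum>t=2..n. scale (c t) (e t))"
    using assms by (rule abelian_ideal_expansion)
  then show ?thesis by (simp add: sum_left scale_left bracket_e_x)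
qed

text \<open>The operator \<open>S\<close> in coordinates: indices move up by one, and the sum stops
  at \<open>n-1\<close> because \<open>e n\<close> is killed.\<close>

lemma bracket_e1:
  assumes "v = (\<Sum>t=2..n. scale (c t) (e t))" "n \<ge> 2"
  shows "bracket v (e 1) = (\<Sum>t=2..n-1. scale (c t) (e (t + 1)))"
proof -
  have "{2..n} = insert n {2..n-1}" using assms(2) by auto
  then show ?thesis
    using assms by (simp add: add_left sum_left scale_left bracket_en_e1 bracket_e_e1 del: One_nat_def)
qed

lemma bracket_e1_closed:
  assumes "v \<in> abelian_ideal" "n \<ge> 2" shows "bracket v (e 1) \<in> abelian_ideal"
proof -
  obtain c where "v = (\<Sum>t=2..n. scale (c t) (e t))"
    using assms(1) by (rule abelian_ideal_expansion)
  then show ?thesis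
    using assms(2) by (simp only: bracket_e1,
      intro subspace_sum subspace_scale subspace_abelian_ideal e_in_abelian_ideal) auto
qed

lemma bracket_abelian:
  assumes "u \<in> abelian_ideal" "v \<in> abelian_ideal" shows "bracket u v = 0"
proof -
  have *: "bracket (e i) v = 0" if "2 \<le> i" "i \<le> n" for i
  proof -
    obtain c where "v = (\<Sum>t=2..n. scale (c t) (e t))"
      using assms(2) by (rule abelian_ideal_expansion)
    then have "bracket v (e i) = 0"
      using that by (simp add: sum_left scale_left bracket_e_e)
    then show ?thesis by (simp add: antisym[of "e i" v])
  qed
  obtain c where "u = (\<Sum>t=2..n. scale (c t) (e t))"
    using assms(1) by (rule abelian_ideal_expansion)
  then show ?thesis by (simp add: sum_left scale_left *)
qed

lemma independent_e:
  assumes "(\<Sum>t=1..n. scale (c t) (e t)) = 0" "t \<in> {1..n}"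
  shows "c t = 0"
proof -
  have "independent (e ` {1..n})"
    using independent_basis by (rule independent_mono) auto
  moreover have "(\<Sum>b\<in>e ` {1..n}. scale (c (inv_into {1..n} e b)) b) = 0"
    using assms(1)
    by (simp add: sum.reindex[OF inj_e] inv_into_f_f[OF inj_e] del: One_nat_def)
  ultimately have "c (inv_into {1..n} e (e t)) = 0"
    using assms(2) by (intro independentD[of "e ` {1..n}" "e ` {1..n}"]) auto
  then show ?thesis using assms(2) by (simp add: inv_into_f_f[OF inj_e] del: One_nat_def)
qed

text \<open>Serves to compare coefficients; a two-term relation is padded with a zero coefficient at
  a spare index.\<close>

lemma independent_three:
  assumes "scale a (e i) + scale b (e j) + scale c (e k) = 0"
    and "{i, j, k} \<subseteq> {1..n}" "i \<noteq> j" "i \<noteq> k" "j \<noteq> k"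
  shows "a = 0 \<and> b = 0 \<and> c = 0"
proof -
  define r where "r t = (if t = i then a else if t = j then b else if t = k then c else 0)" for t
  have "(\<Sum>t=1..n. scale (r t) (e t)) = (\<Sum>t\<in>{i, j, k}. scale (r t) (e t))"
    using assms(2) by (intro sum.mono_neutral_right) (auto simp: r_def)
  also have "\<dots> = 0" using assms by (simp add: r_def add.assoc)
  finally have "r t = 0" if "t \<in> {1..n}" for t using independent_e that by blast
  from this[of i] this[of j] this[of k] show ?thesis
    using assms by (auto simp: r_def)
qed

text \<open>Three instances of the identity suffice: \<open>(v, x)\<close> gives
  \<open>\<phi>\<close> on the ideal, \<open>(e 2, e 1)\<close> fixes the scalars, and
  \<open>(e 1, x)\<close> links the ideal parts of \<open>\<phi> x\<close> and
  \<open>\<phi> (e 1)\<close>.\<close>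

lemma half_derivation:
  assumes "n \<ge> 4"
    and half: "\<And>u v. scale 2 (\<phi> (bracket u v)) = bracket (\<phi> u) v + bracket u (\<phi> v)"
  obtains d w where "w \<in> abelian_ideal" "\<phi> x = scale d x + w"
    "\<phi> (e 1) = scale d (e 1) + bracket w (e 1)"
    "\<And>v. v \<in> abelian_ideal \<Longrightarrow> \<phi> v = scale d v"
proof -
  have n: "1 \<le> n" "2 \<le> n" using assms(1) by auto
  note N = subspace_abelian_ideal
  obtain c d w where w: "w \<in> abelian_ideal" "\<phi> x = scale c (e 1) + scale d x + w"
    using n(1) by (rule decompose)
  obtain a b w' where w': "w' \<in> abelian_ideal" "\<phi> (e 1) = scale a (e 1) + scale b x + w'"
    using n(1) by (rule decompose)
  have on_ideal: "\<phi> v = scale c (bracket v (e 1)) + scale d v" if v: "v \<in> abelian_ideal" for v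
  proof -
    obtain p q y where y: "y \<in> abelian_ideal" "\<phi> v = scale p (e 1) + scale q x + y"
      using n(1) by (rule decompose)
    let ?r = "scale c (bracket v (e 1)) + scale d v"
    have "scale 2 (\<phi> v) = bracket (\<phi> v) x + ?r"
      using half[of v x] v w
      by (simp add: bracket_x add_right scale_right bracket_abelian)
    \<comment> \<open>Bracketing with \<open>x\<close> removes the \<open>e 1\<close> and
      \<open>x\<close> components, so \<open>2 \<phi> v\<close>, and hence \<open>\<phi> v\<close>,
      lies in the ideal. Then \<open>bracket (\<phi> v) x\<close> is \<open>\<phi> v\<close> itself
      and one copy cancels.\<close>
    moreover have "bracket (\<phi> v) x = y"
      using y by (simp add: add_left scale_left bracket_e1_x alternating bracket_x del: One_nat_def)
    moreover have "y + ?r \<in> abelian_ideal"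
      using v y by (intro subspace_add[OF N] subspace_scale[OF N] bracket_e1_closed n)
    ultimately have "scale (1/2) (scale 2 (\<phi> v)) \<in> abelian_ideal"
      using subspace_scale[OF N] by simp
    then have "\<phi> v \<in> abelian_ideal" by simp
    with \<open>scale 2 (\<phi> v) = bracket (\<phi> v) x + ?r\<close>
    have "scale (1 + 1) (\<phi> v) = \<phi> v + ?r" by (simp add: bracket_x)
    then show ?thesis by (simp only: scale_left_distrib scale_one add_left_cancel)
  qed
  \<comment> \<open>This is where n \<ge> 4 enters: \<open>e 4\<close> must be a basis vector for
    the coefficient \<open>c\<close> to be detected.\<close>
  have shift: "bracket (e 2) (e 1) = e 3" "bracket (e 3) (e 1) = e 4"
    using bracket_e_e1[of 2] bracket_e_e1[of 3] assms(1) by simp_all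
  have e: "e 2 \<in> abelian_ideal" "e 3 \<in> abelian_ideal"
    using assms(1) by (auto intro: e_in_abelian_ideal)
  have "scale 2 (scale c (e 4) + scale d (e 3)) =
      scale c (e 4) + scale d (e 3) + (scale a (e 3) + scale b (e 2))"
    using half[of "e 2" "e 1"] w' e
    by (simp add: shift on_ideal add_left add_right scale_left scale_right bracket_x bracket_abelian
        del: One_nat_def)
  then have "scale (1 + 1) (scale c (e 4) + scale d (e 3)) =
      scale c (e 4) + scale d (e 3) + (scale a (e 3) + scale b (e 2))"
    by simp
  then have "scale c (e 4) + scale d (e 3) = scale a (e 3) + scale b (e 2)"
    by (simp only: scale_left_distrib scale_one add_left_cancel)
  then have "scale (- b) (e 2) + scale (d - a) (e 3) + scale c (e 4) = 0"
    by (simp add: scale_left_diff_distrib algebra_simps)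
  from independent_three[OF this] have coeffs: "b = 0" "a = d" "c = 0"
    using assms(1) by auto
  \<comment> \<open>\<open>\<phi>\<close> is only known through the bracket identity, so its value
    at 0 comes from the formula on the ideal. It is needed because
    \<open>bracket (e 1) x = 0\<close>.\<close>
  have phi0: "\<phi> 0 = 0"
    using on_ideal[OF subspace_0[OF N]] by (simp add: zero_left)
  have "0 = w' - bracket w (e 1)"
    using half[of "e 1" x] w w' coeffs
    by (simp add: bracket_e1_x add_left add_right scale_left scale_right bracket_x alternating
        antisym[of "e 1" w] phi0 del: One_nat_def)
  with w w' coeffs on_ideal show thesis
    by (intro that[of w d]) simp_all
qed

end

theorem theorem3p3:
  fixes scale :: "complex \<Rightarrow> 'v::ab_group_add \<Rightarrow> 'v" (infixr "*\<^sub>C" 75)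
    and mult :: "'v \<Rightarrow> 'v \<Rightarrow> 'v" (infixl "\<bullet>" 70)
    and bracket :: "'v \<Rightarrow> 'v \<Rightarrow> 'v"
    and n :: nat and e :: "nat \<Rightarrow> 'v" and x :: 'v
  assumes "n \<ge> 4"
    and "s2_lie_algebra scale bracket n e x"
    and "transposed_poisson_algebra scale mult bracket"
  shows "\<exists>(\<alpha> :: nat \<Rightarrow> complex) (\<gamma>\<^sub>1 :: complex) (\<gamma>\<^sub>2 :: complex).
      e 1 \<bullet> e 1 = (\<Sum>t=4..n. \<alpha> t *\<^sub>C e t) \<and>
      e 1 \<bullet> x = (\<Sum>t=3..n-1. \<alpha> (t + 1) *\<^sub>C e t) + \<gamma>\<^sub>1 *\<^sub>C e n \<and>
      x \<bullet> x = (\<Sum>t=2..n-2. \<alpha> (t + 2) *\<^sub>C e t) + \<gamma>\<^sub>1 *\<^sub>C e (n - 1) + \<gamma>\<^sub>2 *\<^sub>C e n \<and>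
      (\<forall>i\<in>{1..n}. \<forall>j\<in>{1..n}. (i, j) \<noteq> (1, 1) \<longrightarrow> e i \<bullet> e j = 0) \<and>
      (\<forall>i\<in>{2..n}. e i \<bullet> x = 0 \<and> x \<bullet> e i = 0)"
proof -
  interpret L: s2_lie_algebra scale bracket n e x by fact
  interpret P: transposed_poisson_algebra scale mult bracket by fact
  let ?N = L.abelian_ideal
  let ?S = "\<lambda>v. bracket v (e 1)"
  have "\<exists>d w. w \<in> ?N \<and> z \<bullet> x = d *\<^sub>C x + w \<and> z \<bullet> e 1 = d *\<^sub>C e 1 + ?S w \<and>
      (\<forall>v\<in>?N. z \<bullet> v = d *\<^sub>C v)" for z
    using L.half_derivation[where \<phi> = "\<lambda>v. z \<bullet> v", OF assms(1) P.compatible] by metis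
  then obtain d w where w: "\<And>z. w z \<in> ?N" and x: "\<And>z. z \<bullet> x = d z *\<^sub>C x + w z"
    and e1: "\<And>z. z \<bullet> e 1 = d z *\<^sub>C e 1 + ?S (w z)"
    and N: "\<And>z v. v \<in> ?N \<Longrightarrow> z \<bullet> v = d z *\<^sub>C v"
    by metis
  \<comment> \<open>Commuting \<open>e i\<close> with another \<open>e j\<close> of the ideal gives
    \<open>d (e i) *\<^sub>C e j = d (e j) *\<^sub>C e i\<close>; the index \<open>k\<close> is mere
    padding.\<close>
  have d_e: "d (e i) = 0" if i: "i \<in> {2..n}" for i
  proof -
    obtain j where j: "j \<in> {2..n}" "j \<noteq> i"
      using assms(1) by (intro that[of "if i = 2 then 3 else 2"]) auto
    obtain k where k: "k \<in> {1..n}" "k \<noteq> i" "k \<noteq> j"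
      using i j by (intro that[of 1]) auto
    have "d (e i) *\<^sub>C e j = d (e j) *\<^sub>C e i"
      using i j N[of "e j" "e i"] N[of "e i" "e j"] P.commute[of "e i" "e j"]
      by (simp add: L.e_in_abelian_ideal)
    then have "d (e i) *\<^sub>C e j + (- d (e j)) *\<^sub>C e i + 0 *\<^sub>C e k = 0" by simp
    from L.independent_three[OF this] i j k show ?thesis by auto
  qed
  have shift: "?S (e 2) = e 3"
    using L.bracket_e_e1[of 2] assms(1) by simp
  \<comment> \<open>Since \<open>d (e 2) = 0\<close>, commuting \<open>e 2\<close> with
    \<open>x\<close> and with \<open>e 1\<close> computes \<open>w (e 2)\<close> and its image under
    \<open>S\<close>. Comparing them yields a relation between \<open>e 3\<close> and
    \<open>e 2\<close>.\<close>
  have "w (e 2) = d x *\<^sub>C e 2"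
    using x[of "e 2"] N[of "e 2" x] P.commute[of "e 2" x] assms(1) d_e[of 2]
    by (simp add: L.e_in_abelian_ideal)
  moreover have "?S (w (e 2)) = d (e 1) *\<^sub>C e 2"
    using e1[of "e 2"] N[of "e 2" "e 1"] P.commute[of "e 2" "e 1"] assms(1) d_e[of 2]
    by (simp add: L.e_in_abelian_ideal)
  ultimately have "d x *\<^sub>C e 3 + (- d (e 1)) *\<^sub>C e 2 + 0 *\<^sub>C e 1 = 0"
    by (simp add: L.scale_left shift del: One_nat_def)
  from L.independent_three[OF this] have d0: "d x = 0" "d (e 1) = 0"
    using assms(1) by auto
  have xN: "x \<bullet> e i = 0" and e1N: "e 1 \<bullet> e i = 0" if "i \<in> {2..n}" for i
    using N[of "e i"] that d0 by (simp_all add: L.e_in_abelian_ideal)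
  have NN: "e i \<bullet> e j = 0" if "i \<in> {2..n}" "j \<in> {2..n}" for i j
    using N[of "e j" "e i"] that d_e by (simp add: L.e_in_abelian_ideal)
  \<comment> \<open>The last equation uses
    \<open>w (e 1) = e 1 \<bullet> x = x \<bullet> e 1\<close>, which is
    \<open>?S (w x)\<close>.\<close>
  have xx: "x \<bullet> x = w x" and e1x: "e 1 \<bullet> x = ?S (w x)" and e1e1: "e 1 \<bullet> e 1 = ?S (?S (w x))"
    using x[of x] x[of "e 1"] e1[of x] e1[of "e 1"] d0 P.commute[of x "e 1"] by simp_all
  obtain c where c: "w x = (\<Sum>t=2..n. c t *\<^sub>C e t)"
    using w L.abelian_ideal_expansion by metis
  have S1: "?S (w x) = (\<Sum>t=2..n-1. c t *\<^sub>C e (t + 1))"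
    using c assms(1) by (intro L.bracket_e1) auto
  also have "\<dots> = (\<Sum>t=3..n. c (t - 1) *\<^sub>C e t)"
    by (rule sum.reindex_bij_witness[of _ "\<lambda>t. t - 1" "\<lambda>t. t + 1"]) auto
  finally have S1': "?S (w x) = (\<Sum>t=3..n. c (t - 1) *\<^sub>C e t)" .
  \<comment> \<open>A zero coefficient at \<open>t = 2\<close> restores the index range that
    \<open>bracket_e1\<close> expects, so that \<open>S\<close> can be applied again.\<close>
  have "?S (w x) = (\<Sum>t=2..n. (if t = 2 then 0 else c (t - 1)) *\<^sub>C e t)"
    unfolding S1' by (intro sum.mono_neutral_cong_left) auto
  then have "?S (?S (w x)) = (\<Sum>t=2..n-1. (if t = 2 then 0 else c (t - 1)) *\<^sub>C e (t + 1))"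
    using assms(1) by (intro L.bracket_e1) auto
  also have "\<dots> = (\<Sum>t=3..n-1. c (t - 1) *\<^sub>C e (t + 1))"
    by (intro sum.mono_neutral_cong_right) auto
  also have "\<dots> = (\<Sum>t=4..n. c (t - 2) *\<^sub>C e t)"
    by (rule sum.reindex_bij_witness[of _ "\<lambda>t. t - 1" "\<lambda>t. t + 1"]) auto
  finally have S2: "?S (?S (w x)) = (\<Sum>t=4..n. c (t - 2) *\<^sub>C e t)" .
  have S1'': "?S (w x) = (\<Sum>t=3..n-1. c (t - 1) *\<^sub>C e t) + c (n - 1) *\<^sub>C e n"
  proof -
    have "{3..n} = insert n {3..n-1}" using assms(1) by auto
    then show ?thesis using assms(1) by (simp add: S1' add.commute del: One_nat_def)
  qed
  have c': "w x = (\<Sum>t=2..n-2. c t *\<^sub>C e t) + c (n - 1) *\<^sub>C e (n - 1) + c n *\<^sub>C e n"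
  proof -
    have "{2..n} = insert n (insert (n - 1) {2..n-2})" using assms(1) by auto
    moreover have "n \<notin> insert (n - 1) {2..n-2}" "n - 1 \<notin> {2..n-2}"
      using assms(1) by auto
    ultimately show ?thesis using assms(1) by (simp add: c algebra_simps del: One_nat_def)
  qed
  have products: "e i \<bullet> e j = 0"
    if ij: "i \<in> {1..n}" "j \<in> {1..n}" "(i, j) \<noteq> (1, 1)" for i j
  proof -
    consider "i = 1" "j \<in> {2..n}" | "i \<in> {2..n}" "j = 1" | "i \<in> {2..n}" "j \<in> {2..n}"
      using ij by (cases "i = 1"; cases "j = 1") auto
    then show ?thesis
      by cases (use NN e1N P.commute[of "e i" "e 1"] in auto)
  qed
  have with_x: "e i \<bullet> x = 0 \<and> x \<bullet> e i = 0" if "i \<in> {2..n}" for i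
    using xN[OF that] P.commute[of "e i" x] by simp
  show ?thesis
    \<comment> \<open>The coordinates of \<open>w x\<close> that survive two shifts become the
      \<alpha>, with index raised by 2. The coordinate at \<open>n - 1\<close> survives only one
      shift and the one at \<open>n\<close> none, which gives the two \<gamma>.\<close>
    by (rule exI[of _ "\<lambda>t. c (t - 2)"], rule exI[of _ "c (n - 1)"], rule exI[of _ "c n"])
      (use products with_x xx e1x e1e1 S1'' S2 c' in simp)
qed

end
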